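(* For $i=1,\dots,M$ let $A_i=\{\mathbf a_1^{(i)},\dots,\mathbf a_{N_i}^{(i)}\}\subseteq\mathbb Z^n$. Let $\hat{\mathbf a}_j^{(i)}=(\mathbf a_j^{(i)},0,\dots,0,1,0,\dots,0)\in\mathbb Z^{n+M}$, where the $1$ is in the $(n+i)$-th entry, and let $A=\{\hat{\mathbf a}_j^{(i)} : i=1,\dots,M,\ j=1,\dots,N_i\}$. Fix $M'\le M$ and for each $i=1,\dots,M'$ choose an element $\mathbf a_{j_i}^{(i)}\in A_i$. Put $-\beta=\sum_{i=1}^{M'}\mathbf a_{j_i}^{(i)}$, define $v=(v_j^{(i)})_{1\le i\le M,\,1\le j\le N_i}$ by $v_j^{(i)}=-1$ if $i\in\{1,\dots,M'\}$ and $j=j_i$, and $v_j^{(i)}=0$ otherwise, and put $$\hat\beta=\sum_{i=1}^M\sum_{j=1}^{N_i}v_j^{(i)}\hat{\mathbf a}_j^{(i)}=(\beta,-1,\dots,-1,0,\dots,0)\in\mathbb Z^{n+M}$$ ($-1$ appearing $M'$ times and $0$ appearing $M-M'$ times). Then the vector $v\in R_{\hat\beta}$ has minimal negative support, and the series $\Phi_v(\lambda)$ is a solution with integer coefficients of the $A$-hypergeometric system with parameter $\hat\beta$.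
   Context: Index the elements of $A$ and the variables $\lambda=(\lambda_{ij})$ by pairs $(i,j)$, $1\le i\le M$, $1\le j\le N_i$. Let $L$ be the lattice of integer vectors $l=(l_j^{(i)})$ with $\sum_{i,j}l_j^{(i)}\hat{\mathbf a}_j^{(i)}=\mathbf0$. For a vector $v$ let ${\rm nsupp}(v)$ be the set of indices at which $v$ has a negative integer entry, and $L_v=\{l\in L:{\rm nsupp}(v+l)={\rm nsupp}(v)\}$. A vector $v$ has minimal negative support if there is no $l\in L$ for which ${\rm nsupp}(v+l)$ is a proper subset of ${\rm nsupp}(v)$. Writing indices simply as $\iota=(i,j)$, put $[v]_{l_-}=\prod_{l_\iota<0}\prod_{m=1}^{-l_\iota}(v_\iota-m+1)$, $[v+l]_{l_+}=\prod_{l_\iota>0}\prod_{m=1}^{l_\iota}(v_\iota+m)$ and $$\Phi_v(\lambda)=\sum_{l\in L_v}\frac{[v]_{l_-}}{[v+l]_{l_+}}\lambda^{v+l}$$ (for general $A$ the series is normalized by factors $\pi^{\sum_\iota l_\iota}$, with $\pi^{p-1}=-p$, but here $\sum_\iota l_\iota=0$ for all $l\in L$). The $A$-hypergeometric system with parameter $\hat\beta=(\hat\beta_1,\dots,\hat\beta_{n+M})$ consists of the box operators $\Box_l=\prod_{l_\iota>0}(\partial/\partial\lambda_\iota)^{l_\iota}-\prod_{l_\iota<0}(\partial/\partial\lambda_\iota)^{-l_\iota}$ for $l\in L$, and the Euler operators $Z_m=\sum_\iota (\hat{\mathbf a}_\iota)_m\lambda_\iota\,\partial/\partial\lambda_\iota-\hat\beta_m$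 for $m=1,\dots,n+M$; a (formal) solution is a formal series, differentiated term by term, annihilated by all these operators. For a prime $p$, $R$ is the set of vectors with all entries in $\mathbb Q\cap\mathbb Z_p\cap[-1,0]$, and $R_{\hat\beta}$ is the set of $r=(r_\iota)\in R$ with $\sum_\iota r_\iota\hat{\mathbf a}_\iota=\hat\beta$ (here $v\in R_{\hat\beta}$ for every prime $p$). *)

theory Defs
  imports Complex_Main "HOL-Computational_Algebra.Primes"
begin

text \<open>
  Conventions. \<open>I\<close> is a finite index set and \<open>A :: 'i \<Rightarrow> nat \<Rightarrow> int\<close> a family of vectors in
  \<open>\<int>\<^sup>d\<close>: the coordinates of \<open>A \<iota>\<close> are \<open>A \<iota> 1, \<dots>, A \<iota> d\<close>, other arguments are irrelevant.
  A vector indexed by \<open>I\<close> is a function on \<open>'i\<close> that vanishes outside \<open>I\<close>.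
\<close>

definition relation_lattice :: "'i set \<Rightarrow> nat \<Rightarrow> ('i \<Rightarrow> nat \<Rightarrow> int) \<Rightarrow> ('i \<Rightarrow> int) set" where
  "relation_lattice I d A =
     {l. (\<forall>\<iota>. \<iota> \<notin> I \<longrightarrow> l \<iota> = 0) \<and> (\<forall>m\<in>{1..d}. (\<Sum>\<iota>\<in>I. l \<iota> * A \<iota> m) = 0)}"

definition translate :: "('i \<Rightarrow> rat) \<Rightarrow> ('i \<Rightarrow> int) \<Rightarrow> 'i \<Rightarrow> rat" where
  "translate v l = (\<lambda>\<iota>. v \<iota> + of_int (l \<iota>))"

definition nsupp :: "'i set \<Rightarrow> ('i \<Rightarrow> rat) \<Rightarrow> 'i set" where
  "nsupp I v = {\<iota>\<in>I. v \<iota> \<in> \<int> \<and> v \<iota> < 0}"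

definition same_nsupp_lattice ::
    "'i set \<Rightarrow> nat \<Rightarrow> ('i \<Rightarrow> nat \<Rightarrow> int) \<Rightarrow> ('i \<Rightarrow> rat) \<Rightarrow> ('i \<Rightarrow> int) set" where
  "same_nsupp_lattice I d A v =
     {l \<in> relation_lattice I d A. nsupp I (translate v l) = nsupp I v}"

definition minimal_negative_support ::
    "'i set \<Rightarrow> nat \<Rightarrow> ('i \<Rightarrow> nat \<Rightarrow> int) \<Rightarrow> ('i \<Rightarrow> rat) \<Rightarrow> bool" where
  "minimal_negative_support I d A v \<longleftrightarrow>
     \<not> (\<exists>l\<in>relation_lattice I d A. nsupp I (translate v l) \<subset> nsupp I v)"

text \<open>
  \<open>\<rat> \<inter> \<int>\<^sub>p\<close> consists of the rationals whose reduced denominator is prime to \<open>p\<close>.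
\<close>

definition p_integral :: "nat \<Rightarrow> rat set" where
  "p_integral p = {x. \<not> int p dvd snd (quotient_of x)}"

definition R_vectors :: "'i set \<Rightarrow> nat \<Rightarrow> ('i \<Rightarrow> rat) set" where
  "R_vectors I p =
     {r. (\<forall>\<iota>. \<iota> \<notin> I \<longrightarrow> r \<iota> = 0) \<and> (\<forall>\<iota>\<in>I. r \<iota> \<in> p_integral p \<and> - 1 \<le> r \<iota> \<and> r \<iota> \<le> 0)}"

definition R_param ::
    "'i set \<Rightarrow> nat \<Rightarrow> ('i \<Rightarrow> nat \<Rightarrow> int) \<Rightarrow> nat \<Rightarrow> (nat \<Rightarrow> rat) \<Rightarrow> ('i \<Rightarrow> rat) set" where
  "R_param I d A p b =
     {r \<in> R_vectors I p. \<forall>m\<in>{1..d}. (\<Sum>\<iota>\<in>I. r \<iota> * of_int (A \<iota> m)) = b m}"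

text \<open>
  A formal series \<open>\<Sum>\<^sub>u F u \<lambda>\<^sup>u\<close> with rational exponent vectors \<open>u\<close> is the function \<open>F\<close> sending
  an exponent to its coefficient. No condition on the support is needed, because
  \<open>\<partial>/\<partial>\<lambda>\<^sub>\<iota>\<close> and multiplication by \<open>\<lambda>\<^sub>\<iota>\<close> act injectively on exponents.
\<close>

type_synonym 'i formal_series = "('i \<Rightarrow> rat) \<Rightarrow> rat"

definition d_var :: "'i \<Rightarrow> 'i formal_series \<Rightarrow> 'i formal_series" where
  "d_var \<iota> F = (\<lambda>u. (u \<iota> + 1) * F (u(\<iota> := u \<iota> + 1)))"

definition mult_var :: "'i \<Rightarrow> 'i formal_series \<Rightarrow> 'i formal_series" where
  "mult_var \<iota> F = (\<lambda>u. F (u(\<iota> := u \<iota> - 1)))"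

text \<open>
  The composite of \<open>(\<partial>/\<partial>\<lambda>\<^sub>\<iota>)\<^sup>k\<close>, \<open>k = e \<iota>\<close>, over a finite set \<open>J\<close> of indices. The fold does not
  depend on the order because the operators commute.
\<close>

definition d_monomial :: "'i set \<Rightarrow> ('i \<Rightarrow> nat) \<Rightarrow> 'i formal_series \<Rightarrow> 'i formal_series" where
  "d_monomial J e F = Finite_Set.fold (\<lambda>\<iota>. d_var \<iota> ^^ e \<iota>) F J"

lemma d_var_commute: "d_var \<iota> (d_var \<kappa> F) = d_var \<kappa> (d_var \<iota> F)"
  by (cases "\<iota> = \<kappa>") (auto simp: d_var_def fun_eq_iff fun_upd_twist)

lemma comp_fun_commute_d_var_pow: "comp_fun_commute (\<lambda>\<iota>. d_var \<iota> ^^ e \<iota>)"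
proof
  fix \<iota> \<kappa> :: 'a
  have pow: "d_var \<kappa> ((d_var \<iota> ^^ k) F) = (d_var \<iota> ^^ k) (d_var \<kappa> F)" for k and \<iota> \<kappa> :: 'a and F
    by (induction k) (simp_all, metis d_var_commute)
  have "(d_var \<kappa> ^^ r) ((d_var \<iota> ^^ k) F) = (d_var \<iota> ^^ k) ((d_var \<kappa> ^^ r) F)" for k r F
    by (induction r) (simp_all add: pow)
  then show "(d_var \<kappa> ^^ e \<kappa>) \<circ> (d_var \<iota> ^^ e \<iota>) = (d_var \<iota> ^^ e \<iota>) \<circ> (d_var \<kappa> ^^ e \<kappa>)"
    by (intro ext) simp
qed

definition box_op :: "'i set \<Rightarrow> ('i \<Rightarrow> int) \<Rightarrow> 'i formal_series \<Rightarrow> 'i formal_series" where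
  "box_op I l F = (\<lambda>u. d_monomial {\<iota>\<in>I. l \<iota> > 0} (\<lambda>\<iota>. nat (l \<iota>)) F u
                     - d_monomial {\<iota>\<in>I. l \<iota> < 0} (\<lambda>\<iota>. nat (- l \<iota>)) F u)"

definition euler_op ::
    "'i set \<Rightarrow> ('i \<Rightarrow> nat \<Rightarrow> int) \<Rightarrow> (nat \<Rightarrow> rat) \<Rightarrow> nat \<Rightarrow> 'i formal_series \<Rightarrow> 'i formal_series" where
  "euler_op I A b m F =
     (\<lambda>u. (\<Sum>\<iota>\<in>I. of_int (A \<iota> m) * mult_var \<iota> (d_var \<iota> F) u) - b m * F u)"

definition hypergeometric_solution ::
    "'i set \<Rightarrow> nat \<Rightarrow> ('i \<Rightarrow> nat \<Rightarrow> int) \<Rightarrow> (nat \<Rightarrow> rat) \<Rightarrow> 'i formal_series \<Rightarrow> bool" where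
  "hypergeometric_solution I d A b F \<longleftrightarrow>
     (\<forall>l\<in>relation_lattice I d A. box_op I l F = (\<lambda>_. 0)) \<and>
     (\<forall>m\<in>{1..d}. euler_op I A b m F = (\<lambda>_. 0))"

text \<open>
  \<open>bracket_minus I v l\<close> is \<open>[v]\<close> with subscript \<open>l\<^sub>-\<close>, and \<open>bracket_plus I v l\<close> is \<open>[v + l]\<close> with
  subscript \<open>l\<^sub>+\<close>. The latter is nonzero whenever \<open>v + l\<close> and \<open>v\<close> have the same negative support,
  so the quotients in \<open>Phi\<close> are genuine.
\<close>

definition bracket_minus :: "'i set \<Rightarrow> ('i \<Rightarrow> rat) \<Rightarrow> ('i \<Rightarrow> int) \<Rightarrow> rat" where
  "bracket_minus I v l =
     (\<Prod>\<iota>\<in>{\<iota>\<in>I. l \<iota> < 0}. \<Prod>m=1..nat (- l \<iota>). v \<iota> - of_nat m + 1)"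

definition bracket_plus :: "'i set \<Rightarrow> ('i \<Rightarrow> rat) \<Rightarrow> ('i \<Rightarrow> int) \<Rightarrow> rat" where
  "bracket_plus I v l =
     (\<Prod>\<iota>\<in>{\<iota>\<in>I. l \<iota> > 0}. \<Prod>m=1..nat (l \<iota>). v \<iota> + of_nat m)"

text \<open>
  The coefficient of \<open>\<lambda>\<^sup>u\<close> collects the terms with \<open>v + l = u\<close>; there is at most one such \<open>l\<close>.
\<close>

definition Phi ::
    "'i set \<Rightarrow> nat \<Rightarrow> ('i \<Rightarrow> nat \<Rightarrow> int) \<Rightarrow> ('i \<Rightarrow> rat) \<Rightarrow> 'i formal_series" where
  "Phi I d A v =
     (\<lambda>u. \<Sum>l\<in>{l \<in> same_nsupp_lattice I d A v. translate v l = u}.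
            bracket_minus I v l / bracket_plus I v l)"

definition index_set :: "nat \<Rightarrow> (nat \<Rightarrow> nat) \<Rightarrow> (nat \<times> nat) set" where
  "index_set M N = (SIGMA i:{1..M}. {1..N i})"

text \<open>
  Here \<open>a i k\<close> is the \<open>k\<close>-th element of the \<open>i\<close>-th set, a vector with coordinates \<open>1, \<dots>, n\<close>.
\<close>

definition a_hat :: "nat \<Rightarrow> (nat \<Rightarrow> nat \<Rightarrow> nat \<Rightarrow> int) \<Rightarrow> nat \<times> nat \<Rightarrow> nat \<Rightarrow> int" where
  "a_hat n a = (\<lambda>(i, k) m. if m \<le> n then a i k m else if m = n + i then 1 else 0)"

end

theory Submission imports Defs begin

text \<open>
  Writing \<open>[v]\<close> and \<open>[v + l]\<close> coordinatewise as Gamma quotients \<open>\<Gamma>(v\<^sub>\<iota> + 1) / \<Gamma>(v\<^sub>\<iota> + l\<^sub>\<iota> + 1)\<close>, a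
  derivative monomial applied to \<open>\<Phi>\<^sub>v\<close> shifts these quotients, and gives \<open>0\<close> exactly where an
  exponent crosses from the nonnegative to the negative integers. When the negative support of
  \<open>v\<close> is minimal, the coefficient of \<open>\<lambda>\<^sup>u\<close> in the derivative therefore depends on \<open>u\<close> alone and
  not on the monomial, so the two terms of a box operator cancel. For the
  vector \<open>v\<close> at hand, every \<open>l\<close> has coordinate sum \<open>0\<close> on each block \<open>i\<close>; this forces
  minimality, and makes the coefficients signed products of multinomial coefficients.
\<close>

text \<open>This is Gamma(x+1)/Gamma(x+k+1), written with finite products because Gamma has a pole
  when \<open>x\<close> is a negative integer. Since \<open>nat\<close> truncates at 0, at most one
  of the two products is nonempty.\<close>

definition gamma_quotient :: "rat \<Rightarrow> int \<Rightarrow> rat" where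
  "gamma_quotient x k = (\<Prod>m=1..nat (- k). x - of_nat m + 1) / (\<Prod>m=1..nat k. x + of_nat m)"

lemma gamma_quotient_0 [simp]: "gamma_quotient x 0 = 1"
  by (simp add: gamma_quotient_def)

lemma gamma_quotient_step:
  assumes "x + of_int k + 1 \<noteq> 0"
  shows "(x + of_int k + 1) * gamma_quotient x (k + 1) = gamma_quotient x k"
proof (cases "k \<ge> 0")
  case True
  then obtain n where n: "k = int n" using nonneg_int_cases by blast
  have "nat (k + 1) = Suc n" using n by simp
  then have "gamma_quotient x (k + 1) = gamma_quotient x k / (x + of_int k + 1)"
    using n by (simp add: gamma_quotient_def ac_simps)
  then show ?thesis using assms by simp
next
  case False
  then obtain n where n: "k = - int (Suc n)"
    by (metis int_cases not_less of_nat_0_le_iff)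
  have "nat (- k) = Suc n" "nat (- (k + 1)) = n" "nat k = 0" "nat (k + 1) = 0" using n by simp_all
  moreover have "x - of_nat (Suc n) + 1 = x + of_int k + 1" using n by simp
  ultimately show ?thesis by (simp add: gamma_quotient_def mult.commute del: of_nat_Suc)
qed

text \<open>Iterates the functional equation of Gamma. The product on the left is the factor that
  \<open>e\<close> differentiations bring down to the exponent \<open>x + k\<close>; the hypothesis
  says that no exponent passed on the way is 0.\<close>

lemma gamma_quotient_shift:
  assumes "\<forall>m\<in>{1..e}. x + of_int k + of_nat m \<noteq> 0"
  shows "(\<Prod>m=1..e. x + of_int k + of_nat m) * gamma_quotient x (k + int e) = gamma_quotient x k"
  using assms
proof (induction e)
  case (Suc e)
  have "x + of_int k + of_nat (Suc e) \<noteq> 0" using Suc.prems[rule_format, of "Suc e"] by simp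
  then have "(x + of_int k + of_nat (Suc e)) * gamma_quotient x (k + int (Suc e))
      = gamma_quotient x (k + int e)"
    using gamma_quotient_step[of x "k + int e"] by (simp add: algebra_simps)
  with Suc show ?case by (simp add: mult.assoc)
qed simp

text \<open>This value and the next are the ones that occur for the special \<open>v\<close>: a
  shift that keeps the negative support can only raise or keep an entry 0 and only lower or keep an
  entry -1.\<close>

lemma gamma_quotient_zero: "gamma_quotient 0 (int t) = 1 / fact t"
  by (simp add: gamma_quotient_def fact_prod)

lemma gamma_quotient_minus_one: "gamma_quotient (- 1) (- int s) = (- 1) ^ s * fact s"
proof -
  have "gamma_quotient (- 1) (- int s) = (\<Prod>m=1..s. - 1 * of_nat m)"
    by (simp add: gamma_quotient_def)
  also have "\<dots> = (- 1) ^ s * fact s"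
    by (subst prod.distrib) (simp add: fact_prod)
  finally show ?thesis .
qed

text \<open>For an index of the other sign, or with entry 0, the inner product of a bracket is
  empty, so both brackets extend to products over all of \<open>I\<close>.\<close>

lemma bracket_quotient:
  assumes "finite I"
  shows "bracket_minus I v l / bracket_plus I v l = (\<Prod>\<iota>\<in>I. gamma_quotient (v \<iota>) (l \<iota>))"
proof -
  have "bracket_minus I v l = (\<Prod>\<iota>\<in>I. \<Prod>m=1..nat (- l \<iota>). v \<iota> - of_nat m + 1)"
    unfolding bracket_minus_def by (rule prod.mono_neutral_left) (use assms in \<open>auto simp: not_less\<close>)
  moreover have "bracket_plus I v l = (\<Prod>\<iota>\<in>I. \<Prod>m=1..nat (l \<iota>). v \<iota> + of_nat m)"
    unfolding bracket_plus_def by (rule prod.mono_neutral_left) (use assms in \<open>auto simp: not_less\<close>)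
  ultimately show ?thesis by (simp add: gamma_quotient_def prod_dividef)
qed

section \<open>Coefficients of \<open>Phi\<close>\<close>

lemma translate_inject: "translate v l = translate v l' \<longleftrightarrow> l = l'"
  by (auto simp: translate_def fun_eq_iff)

lemma Phi_translate:
  assumes "finite I"
  shows "Phi I d A v (translate v l) =
    (if l \<in> same_nsupp_lattice I d A v then \<Prod>\<iota>\<in>I. gamma_quotient (v \<iota>) (l \<iota>) else 0)"
proof -
  have "{l' \<in> same_nsupp_lattice I d A v. translate v l' = translate v l}
      = (if l \<in> same_nsupp_lattice I d A v then {l} else {})"
    by (auto simp: translate_inject)
  then show ?thesis by (simp add: Phi_def bracket_quotient assms)
qed

lemma Phi_eq_0: "(\<And>l. l \<in> same_nsupp_lattice I d A v \<Longrightarrow> translate v l \<noteq> u) \<Longrightarrow> Phi I d A v u = 0"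
  unfolding Phi_def by (rule sum.neutral) auto

section \<open>Coefficients of derivative monomials\<close>

lemma d_var_funpow:
  "(d_var \<iota> ^^ k) F u = (\<Prod>m=1..k. u \<iota> + of_nat m) * F (u(\<iota> := u \<iota> + of_nat k))"
proof (induction k arbitrary: u)
  case (Suc k)
  have "(\<Prod>m=1..Suc k. u \<iota> + of_nat m) = (u \<iota> + 1) * (\<Prod>m=1..k. u \<iota> + 1 + of_nat m)"
    by (induction k) (simp_all add: ac_simps)
  moreover have "(u(\<iota> := u \<iota> + 1))(\<iota> := u \<iota> + 1 + of_nat k) = u(\<iota> := u \<iota> + of_nat (Suc k))"
    by (simp add: add_ac)
  moreover have "(d_var \<iota> ^^ Suc k) F u = (u \<iota> + 1) * (d_var \<iota> ^^ k) F (u(\<iota> := u \<iota> + 1))"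
    by (simp add: d_var_def)
  ultimately show ?case by (simp only: Suc.IH fun_upd_same mult.assoc)
qed simp

lemma d_monomial_apply:
  assumes "finite J"
  shows "d_monomial J e F u =
    (\<Prod>\<iota>\<in>J. \<Prod>m=1..e \<iota>. u \<iota> + of_nat m) * F (\<lambda>\<iota>. if \<iota> \<in> J then u \<iota> + of_nat (e \<iota>) else u \<iota>)"
  using assms
proof (induction J arbitrary: u rule: finite_induct)
  case empty
  then show ?case by (simp add: d_monomial_def)
next
  case (insert \<kappa> J)
  interpret comp_fun_commute "\<lambda>\<iota>. d_var \<iota> ^^ e \<iota>" by (rule comp_fun_commute_d_var_pow)
  let ?u = "u(\<kappa> := u \<kappa> + of_nat (e \<kappa>))"
  have "d_monomial (insert \<kappa> J) e F u = (\<Prod>m=1..e \<kappa>. u \<kappa> + of_nat m) * d_monomial J e F ?u"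
    using insert by (simp add: d_monomial_def d_var_funpow)
  moreover have "(\<lambda>\<iota>. if \<iota> \<in> J then ?u \<iota> + of_nat (e \<iota>) else ?u \<iota>)
      = (\<lambda>\<iota>. if \<iota> \<in> insert \<kappa> J then u \<iota> + of_nat (e \<iota>) else u \<iota>)"
    using insert.hyps by auto
  moreover have "(\<Prod>\<iota>\<in>J. \<Prod>m=1..e \<iota>. ?u \<iota> + of_nat m) = (\<Prod>\<iota>\<in>J. \<Prod>m=1..e \<iota>. u \<iota> + of_nat m)"
    using insert.hyps by (intro prod.cong) auto
  ultimately show ?case using insert by (simp add: mult.assoc)
qed

section \<open>The differential equations satisfied by \<open>Phi\<close>\<close>

lemma relation_lattice_diff:
  "l \<in> relation_lattice I d A \<Longrightarrow> l' \<in> relation_lattice I d A \<Longrightarrow>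
   (\<lambda>\<iota>. l \<iota> - l' \<iota>) \<in> relation_lattice I d A"
  by (auto simp: relation_lattice_def left_diff_distrib sum_subtractf)

text \<open>Adding a natural number preserves integrality in both directions and does not decrease
  an entry, so entries can only leave the negative integers.\<close>

lemma nsupp_mono:
  assumes "\<And>\<iota>. \<iota> \<in> I \<Longrightarrow> \<exists>e. w \<iota> = u \<iota> + of_nat e"
  shows "nsupp I w \<subseteq> nsupp I u"
proof
  fix \<iota> assume \<iota>: "\<iota> \<in> nsupp I w"
  then obtain e where e: "w \<iota> = u \<iota> + of_nat e" using assms by (auto simp: nsupp_def)
  then have "u \<iota> = w \<iota> - of_nat e" by simp
  then have "u \<iota> \<in> \<int>" using \<iota> by (auto simp: nsupp_def)
  moreover have "u \<iota> \<le> w \<iota>" using e by simp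
  ultimately show "\<iota> \<in> nsupp I u" using \<iota> by (auto simp: nsupp_def)
qed

text \<open>The right-hand side contains neither \<open>J\<close> nor \<open>e\<close>; this makes
  the two monomials of a box operator agree. With u = v + c and w the exponent before
  differentiation, the cases are: w has the wrong support, so its coefficient is 0; both supports
  are that of v, so the Gamma quotients shift; only u has more negative entries, so a factor of the
  derivative is 0.\<close>

lemma d_monomial_Phi:
  assumes I: "finite I" and J: "J \<subseteq> I" and min: "minimal_negative_support I d A v"
    and L: "(\<lambda>\<iota>. if \<iota> \<in> J then c \<iota> + int (e \<iota>) else c \<iota>) \<in> relation_lattice I d A"
  shows "d_monomial J e (Phi I d A v) (translate v c) =
    (if nsupp I (translate v c) = nsupp I v then \<Prod>\<iota>\<in>I. gamma_quotient (v \<iota>) (c \<iota>) else 0)"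
proof -
  \<comment> \<open>Extending the orders by 0 outside \<open>J\<close> turns all products into
    products over \<open>I\<close>.\<close>
  define e' where "e' = (\<lambda>\<iota>. if \<iota> \<in> J then e \<iota> else 0)"
  define l where "l = (\<lambda>\<iota>. c \<iota> + int (e' \<iota>))"
  let ?u = "translate v c" and ?w = "translate v l"
  let ?P = "\<lambda>\<iota>. \<Prod>m=1..e' \<iota>. ?u \<iota> + of_nat m"
  have lL: "l \<in> relation_lattice I d A"
    using L by (simp add: l_def e'_def if_distrib cong: if_cong)
  have w: "?w \<iota> = ?u \<iota> + of_nat (e' \<iota>)" for \<iota> by (simp add: translate_def l_def)
  have "(\<lambda>\<iota>. if \<iota> \<in> J then ?u \<iota> + of_nat (e \<iota>) else ?u \<iota>) = ?w"
    by (auto simp: w e'_def)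
  moreover have "(\<Prod>\<iota>\<in>J. \<Prod>m=1..e \<iota>. ?u \<iota> + of_nat m) = (\<Prod>\<iota>\<in>I. ?P \<iota>)"
    using I J by (intro prod.mono_neutral_cong_left) (auto simp: e'_def)
  ultimately have D: "d_monomial J e (Phi I d A v) ?u = (\<Prod>\<iota>\<in>I. ?P \<iota>) * Phi I d A v ?w"
    using finite_subset[OF J I] by (simp add: d_monomial_apply)
  have sub: "nsupp I ?w \<subseteq> nsupp I ?u" by (rule nsupp_mono) (use w in blast)
  show ?thesis
  proof (cases "nsupp I ?w = nsupp I v")
    case False
    \<comment> \<open>Minimality excludes a proper inclusion and the case excludes equality. As the
      support of w lies in that of u, the latter cannot equal that of v either.\<close>
    then have "\<not> nsupp I ?w \<subseteq> nsupp I v"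
      using min lL by (auto simp: minimal_negative_support_def)
    then have "nsupp I ?u \<noteq> nsupp I v" using sub by auto
    moreover have "Phi I d A v ?w = 0"
      using False by (simp add: Phi_translate[OF I] same_nsupp_lattice_def)
    ultimately show ?thesis using D by simp
  next
    case True
    then have Phi_w: "Phi I d A v ?w = (\<Prod>\<iota>\<in>I. gamma_quotient (v \<iota>) (l \<iota>))"
      using lL by (simp add: Phi_translate[OF I] same_nsupp_lattice_def)
    \<comment> \<open>The product (u+1)...(u+e') contains the factor 0 exactly when the entry moves
      from a negative integer u to u + e' >= 0.\<close>
    have zero: "(?P \<iota> = 0) \<longleftrightarrow> \<iota> \<in> nsupp I ?u - nsupp I ?w" if "\<iota> \<in> I" for \<iota>
    proof
      assume "?P \<iota> = 0"
      then obtain m where m: "m \<in> {1..e' \<iota>}" "?u \<iota> + of_nat m = 0" by auto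
      then have "?u \<iota> = of_int (- int m)" by (simp add: eq_neg_iff_add_eq_0)
      then have "?u \<iota> \<in> \<int>" "?u \<iota> < 0"
        using m(1) by (simp_all del: of_int_minus add: of_int_minus[symmetric])
      then have "\<iota> \<in> nsupp I ?u" using that by (auto simp: nsupp_def)
      moreover have "?w \<iota> \<ge> 0" using m w[of \<iota>] by simp
      ultimately show "\<iota> \<in> nsupp I ?u - nsupp I ?w" by (auto simp: nsupp_def)
    next
      assume A: "\<iota> \<in> nsupp I ?u - nsupp I ?w"
      then obtain z where z: "?u \<iota> = of_int z" "z < 0" by (auto simp: nsupp_def elim!: Ints_cases)
      have "?w \<iota> = of_int (z + int (e' \<iota>))" using w z by simp
      then have "z + int (e' \<iota>) \<ge> 0"
        using A that by (auto simp: nsupp_def simp del: of_int_add)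
      \<comment> \<open>The vanishing factor has m = -z, which is in range because z < 0 <= z +
        e'.\<close>
      then have "nat (- z) \<in> {1..e' \<iota>}" "?u \<iota> + of_nat (nat (- z)) = 0" using z by auto
      then show "?P \<iota> = 0" by (meson finite_atLeastAtMost prod_zero)
    qed
    show ?thesis
    proof (cases "nsupp I ?u = nsupp I v")
      case True': True
      have "?P \<iota> * gamma_quotient (v \<iota>) (l \<iota>) = gamma_quotient (v \<iota>) (c \<iota>)" if "\<iota> \<in> I" for \<iota>
      proof -
        have "?P \<iota> \<noteq> 0" using zero[OF that] True True' by auto
        then have "\<forall>m\<in>{1..e' \<iota>}. v \<iota> + of_int (c \<iota>) + of_nat m \<noteq> 0"
          by (simp add: translate_def)
        from gamma_quotient_shift[OF this] show ?thesis by (simp add: translate_def l_def)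
      qed
      then show ?thesis using D Phi_w True' by (simp flip: prod.distrib)
    next
      case False
      then obtain \<iota> where "\<iota> \<in> I" "?P \<iota> = 0" using sub True zero by (auto simp: nsupp_def)
      then have "(\<Prod>\<iota>\<in>I. ?P \<iota>) = 0" using I by (meson prod_zero)
      then show ?thesis using D False by simp
    qed
  qed
qed

text \<open>Write l as l+ minus l-. The exponents u + l+ and u + l- differ by l, so they lie in v +
  L together or not at all. In the first case \<open>d_monomial_Phi\<close> gives both monomials the
  same coefficient; in the second both coefficients are 0.\<close>

lemma box_op_Phi:
  assumes I: "finite I" and min: "minimal_negative_support I d A v"
    and l: "l \<in> relation_lattice I d A"
  shows "box_op I l (Phi I d A v) u = 0"
proof -
  let ?J1 = "{\<iota>\<in>I. l \<iota> > 0}" and ?J2 = "{\<iota>\<in>I. l \<iota> < 0}"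
  let ?e1 = "\<lambda>\<iota>. nat (l \<iota>)" and ?e2 = "\<lambda>\<iota>. nat (- l \<iota>)"
  have l0: "l \<iota> = 0" if "\<iota> \<notin> I" for \<iota> using l that by (auto simp: relation_lattice_def)
  \<comment> \<open>Outside \<open>?J1\<close> the order \<open>nat (l \<iota>)\<close> is already
    0, so the case distinction disappears; likewise for \<open>?J2\<close>, and for rational
    exponents in \<open>t1\<close> and \<open>t2\<close>.\<close>
  have s1: "(\<lambda>\<iota>. if \<iota> \<in> ?J1 then x \<iota> + int (?e1 \<iota>) else x \<iota>) = (\<lambda>\<iota>. x \<iota> + int (?e1 \<iota>))" for x
    using l0 by (force simp: fun_eq_iff)
  have s2: "(\<lambda>\<iota>. if \<iota> \<in> ?J2 then x \<iota> + int (?e2 \<iota>) else x \<iota>) = (\<lambda>\<iota>. x \<iota> + int (?e2 \<iota>))" for x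
    using l0 by (force simp: fun_eq_iff)
  have t1: "(\<lambda>\<iota>. if \<iota> \<in> ?J1 then x \<iota> + of_nat (?e1 \<iota>) else x \<iota>) = (\<lambda>\<iota>. x \<iota> + of_nat (?e1 \<iota>))"
    for x :: "'a \<Rightarrow> rat"
    using l0 by (force simp: fun_eq_iff)
  have t2: "(\<lambda>\<iota>. if \<iota> \<in> ?J2 then x \<iota> + of_nat (?e2 \<iota>) else x \<iota>) = (\<lambda>\<iota>. x \<iota> + of_nat (?e2 \<iota>))"
    for x :: "'a \<Rightarrow> rat"
    using l0 by (force simp: fun_eq_iff)
  show ?thesis
  proof (cases "\<exists>c. u = translate v c \<and> (\<lambda>\<iota>. c \<iota> + int (?e1 \<iota>)) \<in> relation_lattice I d A")
    case True
    then obtain c where u: "u = translate v c"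
      and c1: "(\<lambda>\<iota>. c \<iota> + int (?e1 \<iota>)) \<in> relation_lattice I d A" by blast
    have "(\<lambda>\<iota>. c \<iota> + int (?e1 \<iota>) - l \<iota>) = (\<lambda>\<iota>. c \<iota> + int (?e2 \<iota>))" by auto
    then have c2: "(\<lambda>\<iota>. c \<iota> + int (?e2 \<iota>)) \<in> relation_lattice I d A"
      using relation_lattice_diff[OF c1 l] by simp
    have "d_monomial ?J1 ?e1 (Phi I d A v) u = d_monomial ?J2 ?e2 (Phi I d A v) u"
      unfolding u
      using d_monomial_Phi[OF I _ min, of ?J1 c ?e1] d_monomial_Phi[OF I _ min, of ?J2 c ?e2]
      unfolding s1 s2 using c1 c2 by auto
    then show ?thesis by (simp add: box_op_def)
  next
    case False
    have shift: "u = translate v (\<lambda>\<iota>. k \<iota> - int (e \<iota>))"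
      if "translate v k = (\<lambda>\<iota>. u \<iota> + of_nat (e \<iota>))" for k e
      using that by (auto simp: translate_def fun_eq_iff algebra_simps)
    have "Phi I d A v (\<lambda>\<iota>. u \<iota> + of_nat (?e1 \<iota>)) = 0"
    proof (rule Phi_eq_0)
      fix k assume "k \<in> same_nsupp_lattice I d A v"
      then show "translate v k \<noteq> (\<lambda>\<iota>. u \<iota> + of_nat (?e1 \<iota>))"
        using False shift[of k ?e1] by (auto simp: same_nsupp_lattice_def)
    qed
    moreover have "Phi I d A v (\<lambda>\<iota>. u \<iota> + of_nat (?e2 \<iota>)) = 0"
    proof (rule Phi_eq_0)
      fix k assume "k \<in> same_nsupp_lattice I d A v"
      then have k: "k \<in> relation_lattice I d A" by (simp add: same_nsupp_lattice_def)
      \<comment> \<open>If u + l- were v + k with k in L, then c = k - l- would contradict the case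
        assumption, since c + l+ = k + l is in L.\<close>
      have "(\<lambda>\<iota>. - l \<iota>) \<in> relation_lattice I d A"
        using l by (auto simp: relation_lattice_def sum_negf)
      from relation_lattice_diff[OF k this]
      have "(\<lambda>\<iota>. k \<iota> - int (?e2 \<iota>) + int (?e1 \<iota>)) \<in> relation_lattice I d A"
        by (rule back_subst[of "\<lambda>x. x \<in> _"]) auto
      then show "translate v k \<noteq> (\<lambda>\<iota>. u \<iota> + of_nat (?e2 \<iota>))"
        using False shift[of k ?e2] by blast
    qed
    ultimately show ?thesis using I
      by (simp add: box_op_def d_monomial_apply t1[simplified] t2[simplified])
  qed
qed

text \<open>Multiplication by a variable after differentiation by it scales the coefficient at u by
  that entry of u. So the Euler operator acts at u by a scalar, which is 0 on v + L because l in L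
  contributes nothing to the weighted sum.\<close>

lemma euler_op_Phi:
  assumes b: "b m = (\<Sum>\<iota>\<in>I. v \<iota> * of_int (A \<iota> m))" and m: "m \<in> {1..d}"
  shows "euler_op I A b m (Phi I d A v) u = 0"
proof (cases "Phi I d A v u = 0")
  case True
  then show ?thesis by (simp add: euler_op_def mult_var_def d_var_def)
next
  case False
  then obtain l where l: "l \<in> relation_lattice I d A" and u: "u = translate v l"
    using Phi_eq_0[of I d A v u] by (auto simp: same_nsupp_lattice_def)
  have "(\<Sum>\<iota>\<in>I. of_int (l \<iota>) * of_int (A \<iota> m)) = (of_int (\<Sum>\<iota>\<in>I. l \<iota> * A \<iota> m) :: rat)"
    by simp
  also have "\<dots> = 0" using l m by (simp add: relation_lattice_def del: of_int_sum)
  finally have "(\<Sum>\<iota>\<in>I. of_int (A \<iota> m) * u \<iota>) = b m"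
    by (simp add: u b translate_def algebra_simps sum.distrib)
  then have "(\<Sum>\<iota>\<in>I. of_int (A \<iota> m) * u \<iota>) * Phi I d A v u = b m * Phi I d A v u" by simp
  then show ?thesis
    by (simp add: euler_op_def mult_var_def d_var_def sum_distrib_right mult.assoc)
qed

text \<open>Valid for arbitrary \<open>A\<close> and \<open>v\<close> with minimal negative support;
  the special vectors are used to establish minimality and integrality.\<close>

theorem hypergeometric_solution_Phi:
  assumes "finite I" "minimal_negative_support I d A v"
    and "\<forall>m\<in>{1..d}. b m = (\<Sum>\<iota>\<in>I. v \<iota> * of_int (A \<iota> m))"
  shows "hypergeometric_solution I d A b (Phi I d A v)"
  unfolding hypergeometric_solution_def
  using box_op_Phi[OF assms(1,2)] euler_op_Phi assms(3) by blast

section \<open>Integrality of multinomial coefficients and of the contribution of one block\<close>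

lemma prod_fact_dvd_fact_sum:
  assumes "finite K"
  shows "(\<Prod>k\<in>K. fact (t k)) dvd (fact (\<Sum>k\<in>K. t k) :: nat)"
  using assms
proof (induction K rule: finite_induct)
  case (insert k K)
  have "fact (t k) * (\<Prod>k\<in>K. fact (t k)) dvd fact (t k) * (fact (\<Sum>k\<in>K. t k) :: nat)"
    using insert.IH by (rule mult_dvd_mono[OF dvd_refl])
  \<comment> \<open>Adjoining an index multiplies the multinomial coefficient by a binomial
    coefficient, which is an integer.\<close>
  also have "\<dots> dvd fact (t k + (\<Sum>k\<in>K. t k))" by (rule fact_fact_dvd_fact)
  finally show ?case using insert.hyps by simp
qed simp

lemma fact_sum_div_prod_fact_Ints:
  assumes "finite K"
  shows "fact (\<Sum>k\<in>K. t k) / (\<Prod>k\<in>K. fact (t k)) \<in> (\<int> :: rat set)"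
proof -
  obtain q where "(fact (\<Sum>k\<in>K. t k) :: nat) = (\<Prod>k\<in>K. fact (t k)) * q"
    using prod_fact_dvd_fact_sum[OF assms] by (rule dvdE)
  then have "(fact (\<Sum>k\<in>K. t k) :: rat) = (\<Prod>k\<in>K. fact (t k)) * of_nat q"
    by (metis (mono_tags, lifting) of_nat_fact of_nat_mult of_nat_prod prod.cong)
  moreover have "(\<Prod>k\<in>K. fact (t k)) \<noteq> (0 :: rat)" using assms by simp
  ultimately show ?thesis by simp
qed

text \<open>Covers a block without a chosen entry: nonnegative shifts with sum 0 all vanish, and the
  block contributes 1.\<close>

lemma prod_gamma_quotient_zero_Ints:
  assumes "finite K" "\<And>k. k \<in> K \<Longrightarrow> l k \<ge> 0" "(\<Sum>k\<in>K. l k) = 0"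
  shows "(\<Prod>k\<in>K. gamma_quotient 0 (l k)) \<in> \<int>"
proof -
  have "l k = 0" if "k \<in> K" for k using assms that by (simp add: sum_nonneg_eq_0_iff)
  then show ?thesis by simp
qed

text \<open>Covers a block with chosen entry \<open>k\<^sub>0\<close>. If the other entries rise by
  t_k, the chosen one falls by their sum s, and the block contributes (-1)^s times the multinomial
  coefficient s! / prod t_k!.\<close>

lemma prod_gamma_quotient_minus_one_Ints:
  assumes K: "finite K" "k\<^sub>0 \<in> K" and nonneg: "\<And>k. k \<in> K \<Longrightarrow> k \<noteq> k\<^sub>0 \<Longrightarrow> l k \<ge> 0"
    and sum0: "(\<Sum>k\<in>K. l k) = 0"
  shows "(\<Prod>k\<in>K. gamma_quotient (if k = k\<^sub>0 then - 1 else 0) (l k)) \<in> \<int>"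
proof -
  define K' where "K' = K - {k\<^sub>0}"
  define t where "t = (\<lambda>k. nat (l k))"
  have l: "l k = int (t k)" if "k \<in> K'" for k using nonneg that by (simp add: K'_def t_def)
  have "l k\<^sub>0 = - (\<Sum>k\<in>K'. l k)" using sum0 K by (simp add: K'_def sum.remove)
  also have "\<dots> = - int (\<Sum>k\<in>K'. t k)" by (simp add: l)
  finally have l0: "l k\<^sub>0 = - int (\<Sum>k\<in>K'. t k)" .
  have "(\<Prod>k\<in>K. gamma_quotient (if k = k\<^sub>0 then - 1 else 0) (l k))
      = gamma_quotient (- 1) (l k\<^sub>0) * (\<Prod>k\<in>K'. gamma_quotient (if k = k\<^sub>0 then - 1 else 0) (l k))"
    using K by (simp add: K'_def prod.remove)
  also have "(\<Prod>k\<in>K'. gamma_quotient (if k = k\<^sub>0 then - 1 else 0) (l k)) = (\<Prod>k\<in>K'. 1 / fact (t k))"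
    by (rule prod.cong) (auto simp: l gamma_quotient_zero, auto simp: K'_def)
  also have "gamma_quotient (- 1) (l k\<^sub>0) * \<dots>
      = (- 1) ^ (\<Sum>k\<in>K'. t k) * (fact (\<Sum>k\<in>K'. t k) / (\<Prod>k\<in>K'. fact (t k)))"
    unfolding l0 gamma_quotient_minus_one by (simp add: prod_dividef)
  also have "\<dots> \<in> \<int>"
    using fact_sum_div_prod_fact_Ints[of K' t] K by (intro Ints_mult Ints_power) (auto simp: K'_def)
  finally show ?thesis .
qed

section \<open>The block structure of the index set and the chosen vector \<open>v\<close>\<close>

lemma finite_index_set [simp]: "finite (index_set M N)"
  by (simp add: index_set_def)

lemma sum_index_set:
  "(\<Sum>\<iota>\<in>index_set M N. f \<iota>) = (\<Sum>i=1..M. \<Sum>k=1..N i. f (i, k))"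
  by (simp add: index_set_def sum.Sigma)

text \<open>Coordinate \<open>n + i\<close> of the vectors \<open>a_hat\<close> is the indicator of
  block \<open>i\<close>, so the relation in this coordinate is the block sum.\<close>

lemma relation_lattice_block_sum:
  assumes l: "l \<in> relation_lattice (index_set M N) (n + M) (a_hat n a)" and i: "i \<in> {1..M}"
  shows "(\<Sum>k=1..N i. l (i, k)) = 0"
proof -
  have "(\<Sum>\<iota>\<in>index_set M N. l \<iota> * a_hat n a \<iota> (n + i)) = 0"
    using l i by (auto simp: relation_lattice_def)
  moreover have "(\<Sum>k=1..N i'. l (i', k) * a_hat n a (i', k) (n + i))
      = (if i' = i then \<Sum>k=1..N i. l (i, k) else 0)" for i'
    using i by (simp add: a_hat_def)
  ultimately show ?thesis using i by (simp add: sum_index_set)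
qed

text \<open>Used with \<open>f\<close> a coordinate of \<open>a_hat\<close> to evaluate the
  parameter vector.\<close>

lemma sum_index_set_choice:
  fixes f :: "nat \<times> nat \<Rightarrow> rat"
  assumes "M' \<le> M" "\<forall>i\<in>{1..M'}. j i \<in> {1..N i}"
  shows "(\<Sum>\<iota>\<in>index_set M N. (\<lambda>(i, k). if i \<in> {1..M'} \<and> k = j i then - 1 else 0) \<iota> * f \<iota>)
    = - (\<Sum>i=1..M'. f (i, j i))"
proof -
  have "(\<Sum>k=1..N i. (if i \<in> {1..M'} \<and> k = j i then - 1 else 0) * f (i, k))
      = (if i \<in> {1..M'} then - f (i, j i) else 0)" for i
  proof -
    have "(\<Sum>k=1..N i. (if i \<in> {1..M'} \<and> k = j i then - 1 else 0) * f (i, k))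
      = (\<Sum>k=1..N i. if k = j i then (if i \<in> {1..M'} then - f (i, j i) else 0) else 0)"
      by (rule sum.cong) auto
    then show ?thesis using assms(2) by (auto simp: sum.delta)
  qed
  then have "(\<Sum>\<iota>\<in>index_set M N. (\<lambda>(i, k). if i \<in> {1..M'} \<and> k = j i then - 1 else 0) \<iota> * f \<iota>)
      = (\<Sum>i=1..M. if i \<in> {1..M'} then - f (i, j i) else 0)"
    unfolding sum_index_set prod.case by (intro sum.cong refl)
  also have "\<dots> = (\<Sum>i=1..M'. - f (i, j i))"
    using assms(1) by (intro sum.mono_neutral_cong_right) auto
  finally show ?thesis by (simp add: sum_negf)
qed

lemma nsupp_choice:
  assumes "M' \<le> M" "\<forall>i\<in>{1..M'}. j i \<in> {1..N i}"
  shows "nsupp (index_set M N) (\<lambda>(i, k). if i \<in> {1..M'} \<and> k = j i then - 1 else 0)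
    = (\<lambda>i. (i, j i)) ` {1..M'}"
proof (intro set_eqI iffI)
  fix \<iota>
  assume "\<iota> \<in> (\<lambda>i. (i, j i)) ` {1..M'}"
  then obtain i where i: "i \<in> {1..M'}" "\<iota> = (i, j i)" by blast
  then have "\<iota> \<in> index_set M N" using assms(1) bspec[OF assms(2) i(1)] by (simp add: index_set_def)
  then show "\<iota> \<in> nsupp (index_set M N) (\<lambda>(i, k). if i \<in> {1..M'} \<and> k = j i then - 1 else 0)"
    using i by (simp add: nsupp_def)
qed (force simp: nsupp_def split: if_splits)

text \<open>If the support shrinks, some chosen entry of a block \<open>i\<close> becomes
  nonnegative, so \<open>l\<close> is at least 1 there. The other entries of that block are 0 in
  \<open>v\<close> and must stay nonnegative. The block sum of \<open>l\<close> is then at least 1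
  instead of 0.\<close>

lemma minimal_negative_support_choice:
  fixes j :: "nat \<Rightarrow> nat"
  assumes M': "M' \<le> M" and j: "\<forall>i\<in>{1..M'}. j i \<in> {1..N i}"
    and v: "v = (\<lambda>(i, k). if i \<in> {1..M'} \<and> k = j i then - 1 else 0)"
  shows "minimal_negative_support (index_set M N) (n + M) (a_hat n a) v"
  unfolding minimal_negative_support_def
proof
  let ?I = "index_set M N"
  have ns: "nsupp ?I v = (\<lambda>i. (i, j i)) ` {1..M'}" unfolding v by (rule nsupp_choice[OF M' j])
  assume "\<exists>l\<in>relation_lattice ?I (n + M) (a_hat n a). nsupp ?I (translate v l) \<subset> nsupp ?I v"
  then obtain l where l: "l \<in> relation_lattice ?I (n + M) (a_hat n a)"
    and sub: "nsupp ?I (translate v l) \<subset> nsupp ?I v" by blast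
  then obtain i where i: "i \<in> {1..M'}" and out: "(i, j i) \<notin> nsupp ?I (translate v l)"
    unfolding ns by blast
  have iM: "i \<in> {1..M}" using i M' by auto
  have ge: "l (i, k) \<ge> (if k = j i then 1 else 0)" if k: "k \<in> {1..N i}" for k
  proof -
    \<comment> \<open>For k = j i this is the choice of i; any other (i, k) is outside the support
      of v, hence outside the smaller one.\<close>
    have "(i, k) \<notin> nsupp ?I (translate v l)" using sub out ns by (cases "k = j i") auto
    then have "translate v l (i, k) \<ge> 0"
      using k iM i by (auto simp: nsupp_def index_set_def translate_def v split: if_splits)
    then show ?thesis using i by (auto simp: translate_def v split: if_splits)
  qed
  have "(\<Sum>k=1..N i. (if k = j i then 1 else 0)) \<le> (\<Sum>k=1..N i. l (i, k))"
    by (rule sum_mono) (use ge in auto)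
  moreover have "(\<Sum>k=1..N i. (if k = j i then 1 else 0)) = (1 :: int)" using j i by auto
  ultimately show False using relation_lattice_block_sum[OF l iM] by simp
qed

text \<open>A nonzero coefficient is a product of Gamma quotients over the index set; grouped by
  blocks, each block product is an integer by the two lemmas on block contributions.\<close>

lemma Phi_choice_Ints:
  fixes j :: "nat \<Rightarrow> nat"
  assumes M': "M' \<le> M" and j: "\<forall>i\<in>{1..M'}. j i \<in> {1..N i}"
    and v: "v = (\<lambda>(i, k). if i \<in> {1..M'} \<and> k = j i then - 1 else 0)"
  shows "Phi (index_set M N) (n + M) (a_hat n a) v u \<in> \<int>"
proof (cases "\<exists>l\<in>same_nsupp_lattice (index_set M N) (n + M) (a_hat n a) v. u = translate v l")
  case False
  then have "Phi (index_set M N) (n + M) (a_hat n a) v u = 0" by (intro Phi_eq_0) auto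
  then show ?thesis by simp
next
  case True
  let ?I = "index_set M N"
  have ns: "nsupp ?I v = (\<lambda>i. (i, j i)) ` {1..M'}" unfolding v by (rule nsupp_choice[OF M' j])
  obtain l where l: "l \<in> same_nsupp_lattice ?I (n + M) (a_hat n a) v" and u: "u = translate v l"
    using True by blast
  then have lL: "l \<in> relation_lattice ?I (n + M) (a_hat n a)"
    and nsl: "nsupp ?I (translate v l) = (\<lambda>i. (i, j i)) ` {1..M'}"
    using ns by (auto simp: same_nsupp_lattice_def)
  \<comment> \<open>An entry 0 of \<open>v\<close> is outside the common negative support, so its
    shifted value, which is \<open>l\<close> itself, is nonnegative.\<close>
  have nonneg: "l (i, k) \<ge> 0" if "(i, k) \<in> ?I" "\<not> (i \<in> {1..M'} \<and> k = j i)" for i k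
  proof -
    have "(i, k) \<notin> nsupp ?I (translate v l)" using that nsl by auto
    then show ?thesis using that by (auto simp: nsupp_def translate_def v)
  qed
  have "(\<Prod>k=1..N i. gamma_quotient (v (i, k)) (l (i, k))) \<in> \<int>" if i: "i \<in> {1..M}" for i
  proof (cases "i \<in> {1..M'}")
    case True
    then have "(\<Prod>k=1..N i. gamma_quotient (if k = j i then - 1 else 0) (l (i, k))) \<in> \<int>"
      using j i nonneg relation_lattice_block_sum[OF lL i]
      by (intro prod_gamma_quotient_minus_one_Ints) (auto simp: index_set_def)
    then show ?thesis using True by (simp add: v)
  next
    case False
    then have "(\<Prod>k=1..N i. gamma_quotient 0 (l (i, k))) \<in> \<int>"
      using i nonneg relation_lattice_block_sum[OF lL i]
      by (intro prod_gamma_quotient_zero_Ints) (auto simp: index_set_def)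
    moreover have "v (i, k) = 0" for k using False by (auto simp: v)
    ultimately show ?thesis by simp
  qed
  then have "(\<Prod>i=1..M. \<Prod>k=1..N i. gamma_quotient (v (i, k)) (l (i, k))) \<in> \<int>"
    by (rule Ints_prod)
  moreover have "Phi ?I (n + M) (a_hat n a) v u
      = (\<Prod>i=1..M. \<Prod>k=1..N i. gamma_quotient (v (i, k)) (l (i, k)))"
    using l by (simp add: u Phi_translate) (simp add: index_set_def prod.Sigma)
  ultimately show ?thesis by simp
qed

theorem proposition5p4:
  fixes n M M' :: nat
    and N :: "nat \<Rightarrow> nat"
    and a :: "nat \<Rightarrow> nat \<Rightarrow> nat \<Rightarrow> int"
    and j :: "nat \<Rightarrow> nat"
    and \<beta> :: "nat \<Rightarrow> int"
    and v :: "nat \<times> nat \<Rightarrow> rat"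
    and \<beta>hat :: "nat \<Rightarrow> rat"
  assumes "M' \<le> M"
    and "\<forall>i\<in>{1..M'}. j i \<in> {1..N i}"
    and "\<forall>m\<in>{1..n}. - \<beta> m = (\<Sum>i=1..M'. a i (j i) m)"
    and "v = (\<lambda>(i, k). if i \<in> {1..M'} \<and> k = j i then - 1 else 0)"
    and "\<forall>m\<in>{1..n+M}. \<beta>hat m = (\<Sum>\<iota>\<in>index_set M N. v \<iota> * of_int (a_hat n a \<iota> m))"
  shows "(\<forall>m\<in>{1..n}. \<beta>hat m = of_int (\<beta> m)) \<and>
         (\<forall>m\<in>{n+1..n+M'}. \<beta>hat m = - 1) \<and>
         (\<forall>m\<in>{n+M'+1..n+M}. \<beta>hat m = 0) \<and>
         (\<forall>p. prime p \<longrightarrow> v \<in> R_param (index_set M N) (n + M) (a_hat n a) p \<beta>hat) \<and>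
         minimal_negative_support (index_set M N) (n + M) (a_hat n a) v \<and>
         (\<forall>u. Phi (index_set M N) (n + M) (a_hat n a) v u \<in> \<int>) \<and>
         hypergeometric_solution (index_set M N) (n + M) (a_hat n a) \<beta>hat
           (Phi (index_set M N) (n + M) (a_hat n a) v)"
proof -
  note M' = assms(1) and j = assms(2) and v = assms(4) and \<beta>hat = assms(5)
  let ?I = "index_set M N"
  have b: "\<beta>hat m = - (\<Sum>i=1..M'. of_int (a_hat n a (i, j i) m))" if "m \<in> {1..n+M}" for m
    unfolding bspec[OF \<beta>hat that] v
    by (rule sum_index_set_choice[OF M' j, of "\<lambda>\<iota>. of_int (a_hat n a \<iota> m)"])
  \<comment> \<open>In coordinate \<open>n + i\<close> only the vector chosen from block
    \<open>i\<close> contributes, and such a vector exists exactly when i is at most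
    \<open>M'\<close>.\<close>
  have block: "\<beta>hat (n + i) = (if i \<in> {1..M'} then - 1 else 0)" if "i \<in> {1..M}" for i
  proof -
    have "a_hat n a (i', j i') (n + i) = (if i = i' then 1 else 0)" for i'
      using that by (simp add: a_hat_def)
    then have "(\<Sum>i'=1..M'. rat_of_int (a_hat n a (i', j i') (n + i)))
        = (\<Sum>i'=1..M'. if i = i' then 1 else 0)"
      by (intro sum.cong) simp_all
    also have "\<dots> = (if i \<in> {1..M'} then 1 else 0)" by (rule sum.delta') simp
    finally show ?thesis using b[of "n + i"] that by simp
  qed
  have "\<beta>hat m = of_int (\<beta> m)" if m: "m \<in> {1..n}" for m
  proof -
    have "\<beta>hat m = - (\<Sum>i=1..M'. of_int (a i (j i) m))" using b[of m] m by (simp add: a_hat_def)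
    also have "\<dots> = of_int (- (\<Sum>i=1..M'. a i (j i) m))" by simp
    also have "- (\<Sum>i=1..M'. a i (j i) m) = \<beta> m" using bspec[OF assms(3) m] by linarith
    finally show ?thesis .
  qed
  moreover have "\<beta>hat m = - 1" if "m \<in> {n+1..n+M'}" for m
    using block[of "m - n"] that M' by (auto simp: le_diff_conv Suc_le_eq)
  moreover have "\<beta>hat m = 0" if "m \<in> {n+M'+1..n+M}" for m
    using block[of "m - n"] that by (auto simp: le_diff_conv Suc_le_eq)
  moreover have "v \<in> R_param ?I (n + M) (a_hat n a) p \<beta>hat" if "prime p" for p
  proof -
    \<comment> \<open>The entries -1 and 0 have reduced denominator 1, which is prime to every
      p.\<close>
    have "\<not> int p dvd 1" using prime_gt_1_nat[OF that] by simp
    moreover have "quotient_of (- 1) = (- 1, 1)" "quotient_of 0 = (0, 1)"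
      by simp_all
    ultimately have "(- 1 :: rat) \<in> p_integral p" "(0 :: rat) \<in> p_integral p"
      by (simp_all add: p_integral_def)
    then have "v \<iota> \<in> p_integral p \<and> - 1 \<le> v \<iota> \<and> v \<iota> \<le> 0" for \<iota>
      by (cases \<iota>) (simp add: v)
    moreover have "v \<iota> = 0" if "\<iota> \<notin> ?I" for \<iota>
      using that M' j by (cases \<iota>) (auto simp: v index_set_def)
    ultimately have "v \<in> R_vectors ?I p" by (simp add: R_vectors_def)
    then show ?thesis using \<beta>hat by (simp add: R_param_def)
  qed
  ultimately show ?thesis
    using minimal_negative_support_choice[OF M' j v] Phi_choice_Ints[OF M' j v] \<beta>hat
      hypergeometric_solution_Phi[OF finite_index_set minimal_negative_support_choice[OF M' j v]]
    by blast
qed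

end
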